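(* As formal power series in $q$, \[ \sum_{n\geq 1} \frac{q^n}{1+q^n}\,\frac{1}{(q;q)_{n-1}} \;=\; \sum_{n\geq 1} \frac{q^{n(n+1)/2}}{(q^2;q^2)_n\,(q^{n+1};q)_\infty}. \]
   Context: For a non-negative integer $L$, $(a;q)_L=\prod_{i=0}^{L-1}(1-aq^i)$ (so $(a;q)_0=1$), and $(a;q)_\infty=\lim_{L\to\infty}(a;q)_L$. *)

theory Defs
  imports "HOL-Computational_Algebra.Formal_Power_Series" "HOL-Analysis.Infinite_Sum"
begin

definition qpoch :: "'a::comm_ring_1 \<Rightarrow> 'a \<Rightarrow> nat \<Rightarrow> 'a" where
  "qpoch a q L = (\<Prod>i<L. 1 - a * q ^ i)"

(* On fps the limit is taken in the library's metric topology: every coefficient is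
   eventually constant. *)
definition qpoch_inf :: "'a::{comm_ring_1, t2_space} \<Rightarrow> 'a \<Rightarrow> 'a" where
  "qpoch_inf a q = lim (\<lambda>L. qpoch a q L)"

end

theory Submission
  imports Defs
begin

unbundle fps_syntax

text \<open>
  Put $L_k(N) = \sum_{n<N} q^n / ((1 + q^{n+k})\,(q;q)_n)$, so that $q\,L_1(M)$ is the $M$-th partial
  sum of the left-hand side. Splitting
  $(1+q^k)/(1+q^{n+k}) = 1 + q^k (1-q^n)/(1+q^{n+k})$ and telescoping
  $\sum_{n\le N} q^n/(q;q)_n = 1/(q;q)_N$ gives
  \[ (1+q^k)\,L_k(N+1) = \frac{1}{(q;q)_N} + q^{k+1} L_{k+1}(N). \]
  Iterating yields the finite identity
  \[ \sum_{n=1}^{M} \frac{q^n}{(1+q^n)(q;q)_{n-1}}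
      = \sum_{n=1}^{M} \frac{q^{n(n+1)/2}}{(-q;q)_n\,(q;q)_{M-n}}, \]
  whose right-hand terms agree modulo $q^{M+1}$ with those of the infinite series, because
  $(q;q)_{M-n} \equiv (q;q)_\infty$ modulo $q^{M-n+1}$ and $n(n+1)/2 \ge n$.
\<close>

section \<open>Algebra of finite q-Pochhammer symbols\<close>

lemma qpoch_0 [simp]: "qpoch a q 0 = 1"
  by (simp add: qpoch_def)

lemma qpoch_Suc: "qpoch a q (Suc n) = qpoch a q n * (1 - a * q ^ n)"
  by (simp add: qpoch_def)

lemma qpoch_add: "qpoch a q (m + n) = qpoch a q m * qpoch (a * q ^ m) q n"
  by (induction n) (simp_all add: qpoch_Suc power_add mult.assoc)

lemma qpoch_Suc_left: "qpoch a q (Suc n) = (1 - a) * qpoch (a * q) q n"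
  using qpoch_add[of a q 1 n] by (simp add: qpoch_Suc)

lemma qpoch_square: "qpoch (a ^ 2) (q ^ 2) n = qpoch a q n * qpoch (- a) q n"
proof (induction n)
  case (Suc n)
  have "1 - a\<^sup>2 * (q\<^sup>2) ^ n = (1 - a * q ^ n) * (1 + a * q ^ n)"
    by (simp add: algebra_simps power2_eq_square power_mult_distrib)
  then show ?case
    by (simp add: qpoch_Suc Suc.IH mult_ac)
qed simp

lemma dvd_qpoch_diff_1: "a dvd qpoch a q n - 1"
proof (induction n)
  case (Suc n)
  have "qpoch a q (Suc n) - 1 = (qpoch a q n - 1) - a * (q ^ n * qpoch a q n)"
    by (simp add: qpoch_Suc algebra_simps)
  then show ?case
    using Suc by (metis dvd_diff dvd_triv_left)
qed simp

text \<open>The additional factors form \<open>qpoch (a * q ^ m) q n\<close>, and each of them is 1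
  modulo \<open>a * q ^ m\<close>. All later truncation estimates rest on this.\<close>

lemma dvd_qpoch_diff: "a * q ^ m dvd qpoch a q (m + n) - qpoch a q m"
proof -
  have "qpoch a q (m + n) - qpoch a q m = qpoch a q m * (qpoch (a * q ^ m) q n - 1)"
    by (simp add: qpoch_add algebra_simps)
  then show ?thesis
    using dvd_qpoch_diff_1[of "a * q ^ m" q n] by (metis dvd_mult)
qed

lemma qpoch_nth_0 [simp]:
  fixes a :: "'a::comm_ring_1 fps"
  assumes "a $ 0 = 0"
  shows "qpoch a q n $ 0 = 1"
  by (induction n) (simp_all add: qpoch_Suc assms)

section \<open>Congruences modulo powers of \<open>fps_X\<close> and coefficientwise
  summation\<close>

lemma fps_X_power_dvd_iff:
  fixes f :: "'a::comm_ring_1 fps"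
  shows "fps_X ^ k dvd f \<longleftrightarrow> (\<forall>i<k. f $ i = 0)"
proof
  assume *: "\<forall>i<k. f $ i = 0"
  have "f = fps_X ^ k * Abs_fps (\<lambda>i. f $ (i + k))"
    by (rule fps_ext) (use * in \<open>simp add: fps_X_power_mult_nth\<close>)
  then show "fps_X ^ k dvd f"
    by (metis dvd_triv_left)
qed (auto simp: fps_X_power_mult_nth)

text \<open>Carries a congruence between denominators over to their reciprocals, by 1/a - 1/b = (b -
  a)/(ab).\<close>

lemma dvd_inverse_diff_fps:
  fixes a b d :: "'a::field fps"
  assumes "d dvd a - b" "a $ 0 \<noteq> 0" "b $ 0 \<noteq> 0"
  shows "d dvd inverse a - inverse b"
proof -
  have "inverse a - inverse b = inverse a * inverse b * (b - a)"
    using inverse_mult_eq_1[OF assms(2)] inverse_mult_eq_1[OF assms(3)]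
    by (simp add: algebra_simps)
  moreover have "d dvd b - a"
    using assms(1) by (metis dvd_minus_iff minus_diff_eq)
  ultimately show ?thesis
    by simp
qed

text \<open>Only terms of index at most \<open>j\<close> reach coefficient \<open>j\<close>, so each
  coefficient is a finite sum. Two such series therefore agree once, for every M, their M-th partial
  sums agree in coefficient M.\<close>

lemma has_sum_fps_triangular:
  fixes f :: "nat \<Rightarrow> 'a::ab_group_add fps"
  assumes "\<And>n j. j < n \<Longrightarrow> f n $ j = 0"
  shows "(f has_sum Abs_fps (\<lambda>j. \<Sum>n=1..j. f n $ j)) {1..}"
proof (rule has_sum_fpsI)
  fix j
  have sub: "{n \<in> {1..}. f n $ j \<noteq> 0} \<subseteq> {1..j}"
    using assms by (force simp: not_less[symmetric])
  then show "finite {n \<in> {1..}. f n $ j \<noteq> 0}"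
    by (rule finite_subset) simp
  show "Abs_fps (\<lambda>j. \<Sum>n=1..j. f n $ j) $ j
    = (\<Sum>n | n \<in> {1..} \<and> f n $ j \<noteq> 0. f n $ j)"
    using sub by (auto intro!: sum.mono_neutral_right)
qed

section \<open>Convergence of the infinite products\<close>

lemma qpoch_fps_X_nth:
  assumes "i < m + L" "L \<le> L'"
  shows "qpoch (fps_X ^ m) (fps_X :: 'a::comm_ring_1 fps) L' $ i = qpoch (fps_X ^ m) fps_X L $ i"
proof -
  obtain d where L': "L' = L + d"
    using assms(2) le_Suc_ex by blast
  have "fps_X ^ (m + L) dvd qpoch (fps_X ^ m) (fps_X :: 'a fps) L' - qpoch (fps_X ^ m) fps_X L"
    unfolding L' power_add by (rule dvd_qpoch_diff)
  then show ?thesis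
    using assms(1) unfolding fps_X_power_dvd_iff by (metis eq_iff_diff_eq_0 fps_sub_nth)
qed

lemma qpoch_tendsto_fps:
  fixes m :: nat
  shows "(\<lambda>L. qpoch (fps_X ^ m) fps_X L) \<longlonglongrightarrow>
    Abs_fps (\<lambda>j. qpoch (fps_X ^ m) (fps_X :: 'a::comm_ring_1 fps) (Suc j) $ j)"
proof (rule tendsto_fpsI)
  fix j
  have "qpoch (fps_X ^ m) (fps_X :: 'a fps) L $ j = qpoch (fps_X ^ m) fps_X (Suc j) $ j"
    if "L \<ge> Suc j" for L
    using that by (intro qpoch_fps_X_nth) simp_all
  then show "\<forall>\<^sub>F L in sequentially. qpoch (fps_X ^ m) (fps_X :: 'a fps) L $ j
      = Abs_fps (\<lambda>j. qpoch (fps_X ^ m) fps_X (Suc j) $ j) $ j"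
    unfolding eventually_sequentially fps_nth_Abs_fps by blast
qed

lemma fps_X_power_dvd_qpoch_inf_diff:
  "fps_X ^ (m + L) dvd qpoch_inf (fps_X ^ m) (fps_X :: 'a::comm_ring_1 fps) - qpoch (fps_X ^ m) fps_X L"
proof -
  have "(\<lambda>d. qpoch (fps_X ^ m) fps_X d) \<longlonglongrightarrow> qpoch_inf (fps_X ^ m) (fps_X :: 'a fps)"
    using qpoch_tendsto_fps[of m] unfolding qpoch_inf_def by (metis limI)
  then have ev: "\<forall>\<^sub>F d in sequentially. qpoch (fps_X ^ m) fps_X d $ i
      = qpoch_inf (fps_X ^ m) (fps_X :: 'a fps) $ i" for i
    by (simp add: tendsto_fps_iff)
  show ?thesis
    unfolding fps_X_power_dvd_iff
  proof (intro allI impI)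
    fix i assume i: "i < m + L"
    obtain N where N: "\<And>d. d \<ge> N \<Longrightarrow> qpoch (fps_X ^ m) fps_X d $ i
        = qpoch_inf (fps_X ^ m) (fps_X :: 'a fps) $ i"
      using ev[of i] unfolding eventually_sequentially by blast
    \<comment> \<open>The length \<open>L + N\<close> is at least \<open>L\<close>, where
      coefficient \<open>i\<close> is already stable, and at least \<open>N\<close>, where it equals
      that of the limit.\<close>
    have "qpoch (fps_X ^ m) fps_X (L + N) $ i = qpoch (fps_X ^ m) (fps_X :: 'a fps) L $ i"
      using i by (intro qpoch_fps_X_nth) simp_all
    then show "(qpoch_inf (fps_X ^ m) fps_X - qpoch (fps_X ^ m) (fps_X :: 'a fps) L) $ i = 0"
      using N[of "L + N"] by simp
  qed
qed

section \<open>The finite identity\<close>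

lemma triangle_Suc: "Suc n * (Suc n + 1) div 2 = n * (n + 1) div 2 + Suc n"
proof -
  have "Suc n * (Suc n + 1) = n * (n + 1) + Suc n * 2"
    by (simp add: algebra_simps)
  then show ?thesis by simp
qed

definition lambert_sum :: "nat \<Rightarrow> nat \<Rightarrow> 'a::field fps" where
  "lambert_sum k N =
    (\<Sum>n<N. fps_X ^ n * inverse (1 + fps_X ^ (n + k)) * inverse (qpoch fps_X fps_X n))"

lemma inverse_qpoch_Suc:
  "inverse (qpoch fps_X fps_X n) =
    (1 - fps_X ^ Suc n) * inverse (qpoch fps_X (fps_X :: 'a::field fps) (Suc n))"
proof -
  have "(1 - fps_X ^ Suc n) * inverse (1 - fps_X ^ Suc n :: 'a fps) = 1"
    by (rule inverse_mult_eq_1') simp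
  then show ?thesis
    by (simp add: qpoch_Suc fps_inverse_mult mult.left_commute)
qed

text \<open>Induction on \<open>N\<close> absorbs the telescoping. The condition on \<open>k\<close>
  gives \<open>1 + fps_X ^ k\<close> constant term 1, hence an inverse.\<close>

lemma lambert_sum_rec:
  assumes "k \<ge> 1"
  shows "(1 + fps_X ^ k) * lambert_sum k (Suc N) =
    inverse (qpoch fps_X (fps_X :: 'a::field fps) N) + fps_X ^ (k + 1) * lambert_sum (k + 1) N"
proof (induction N)
  case 0
  have "(1 + fps_X ^ k) * inverse (1 + fps_X ^ k :: 'a fps) = 1"
    by (rule inverse_mult_eq_1') (use assms in simp)
  then show ?case
    by (simp add: lambert_sum_def)
next
  case (Suc N)
  define u where "u = inverse (1 + fps_X ^ (Suc N + k) :: 'a fps)"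
  define w where "w = inverse (qpoch fps_X (fps_X :: 'a fps) (Suc N))"
  have u: "u + fps_X ^ (Suc N + k) * u = 1"
    using inverse_mult_eq_1'[of "1 + fps_X ^ (Suc N + k) :: 'a fps"]
    by (simp add: u_def algebra_simps)
  have w: "inverse (qpoch fps_X (fps_X :: 'a fps) N) = (1 - fps_X ^ Suc N) * w"
    unfolding w_def by (rule inverse_qpoch_Suc)
  have last_term: "lambert_sum k (Suc (Suc N)) = lambert_sum k (Suc N) + fps_X ^ Suc N * u * w"
    by (simp only: lambert_sum_def sum.lessThan_Suc u_def w_def)
  have "(1 + fps_X ^ k) * lambert_sum k (Suc (Suc N))
      = (1 - fps_X ^ Suc N) * w + fps_X ^ (k + 1) * lambert_sum (k + 1) N
        + (1 + fps_X ^ k) * (fps_X ^ Suc N * u * w)"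
    using Suc.IH unfolding w last_term distrib_left[of "1 + fps_X ^ k"] by simp
  \<comment> \<open>The regrouping completes \<open>lambert_sum (k + 1) N\<close> by its next term,
    whose factor 1/(q;q)_N is \<open>(1 - fps_X ^ Suc N) * w\<close>. What remains is a multiple of
    a bracket that vanishes by \<open>u\<close>.\<close>
  also have "\<dots> = w + fps_X ^ (k + 1) *
      (lambert_sum (k + 1) N + fps_X ^ N * u * ((1 - fps_X ^ Suc N) * w))
      + fps_X ^ Suc N * w * (u + fps_X ^ (Suc N + k) * u - 1)"
    by (simp add: algebra_simps power_add)
  also have "lambert_sum (k + 1) N + fps_X ^ N * u * ((1 - fps_X ^ Suc N) * w)
      = lambert_sum (k + 1) (Suc N)"
    by (simp add: lambert_sum_def u_def w)
  finally show ?case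
    by (simp only: u w_def diff_self mult_zero_right add_0_right)
qed

text \<open>Each use of the recursion splits off one term and raises \<open>k\<close>, so the
  induction keeps \<open>k\<close> arbitrary. The exponent collects the factors q^(k+1), ...,
  q^(k+n), and the first denominator collects 1 + q^k, ..., 1 + q^(k+n).\<close>

lemma lambert_sum_eq:
  assumes "k \<ge> 1"
  shows "lambert_sum k M = (\<Sum>n<M. fps_X ^ (n * k + n * (n + 1) div 2) *
    inverse (qpoch (- (fps_X ^ k)) fps_X (Suc n)) *
    inverse (qpoch fps_X (fps_X :: 'a::field fps) (M - Suc n)))"
  using assms
proof (induction M arbitrary: k)
  case 0
  then show ?case by (simp add: lambert_sum_def)
next
  case (Suc M)
  define v where "v = inverse (1 + fps_X ^ k :: 'a fps)"
  have v: "v * (1 + fps_X ^ k) = 1"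
    unfolding v_def by (rule inverse_mult_eq_1) (use Suc.prems in simp)
  \<comment> \<open>The first factor is peeled off, not the last: what is left is the product
    belonging to \<open>k + 1\<close>.\<close>
  have p: "inverse (qpoch (- (fps_X ^ k)) (fps_X :: 'a fps) (Suc n))
      = v * inverse (qpoch (- (fps_X ^ (k + 1))) fps_X n)" for n
    by (simp add: qpoch_Suc_left v_def fps_inverse_mult mult.commute)
  have e: "Suc n * k + Suc n * (Suc n + 1) div 2 = (k + 1) + (n * (k + 1) + n * (n + 1) div 2)" for n
    using triangle_Suc[of n] by simp
  have "lambert_sum k (Suc M) = v * ((1 + fps_X ^ k) * lambert_sum k (Suc M) :: 'a fps)"
    using v by (simp add: mult.assoc[symmetric])
  also have "\<dots> = v * inverse (qpoch fps_X fps_X M)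
      + v * (fps_X ^ (k + 1) * lambert_sum (k + 1) M)"
    by (simp only: lambert_sum_rec[OF Suc.prems] distrib_left)
  also have "v * (fps_X ^ (k + 1) * lambert_sum (k + 1) M) =
    (\<Sum>n<M. fps_X ^ (Suc n * k + Suc n * (Suc n + 1) div 2) *
      inverse (qpoch (- (fps_X ^ k)) fps_X (Suc (Suc n))) *
      inverse (qpoch fps_X (fps_X :: 'a fps) (M - Suc n)))"
    unfolding Suc.IH[OF le_add2] e p sum_distrib_left
    by (intro sum.cong refl) (simp add: power_add algebra_simps)
  finally show ?case
    by (simp add: sum.lessThan_Suc_shift p[of 0, simplified] del: sum.lessThan_Suc mult_Suc)
qed

lemma sum_lambert_eq_sum_theta_finite:
  "(\<Sum>n=1..M. fps_X ^ n / (1 + fps_X ^ n) * (1 / qpoch fps_X fps_X (n - 1))) =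
   (\<Sum>n=1..M. fps_X ^ (n * (n + 1) div 2) *
     inverse (qpoch (- fps_X) fps_X n * qpoch fps_X (fps_X :: 'a::field fps) (M - n)))"
proof -
  have shift: "(\<Sum>n=1..M. g n) = (\<Sum>n<M. g (Suc n))" for g :: "nat \<Rightarrow> 'a fps"
    by (simp add: sum.atLeast1_atMost_eq lessThan_atLeast0)
  \<comment> \<open>The additional 1 is the factor \<open>fps_X\<close> in front of
    \<open>lambert_sum 1 M\<close>; it turns the exponent for k = 1 into the next triangular
    number.\<close>
  have e: "Suc n * (Suc n + 1) div 2 = Suc (n + n * (n + 1) div 2)" for n
    using triangle_Suc[of n] by simp
  have "(\<Sum>n=1..M. fps_X ^ n / (1 + fps_X ^ n) * (1 / qpoch fps_X fps_X (n - 1)))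
      = fps_X * (lambert_sum 1 M :: 'a fps)"
    unfolding shift lambert_sum_def sum_distrib_left
    by (intro sum.cong refl) (simp add: fps_divide_unit mult.assoc)
  also have "\<dots> = (\<Sum>n=1..M. fps_X ^ (n * (n + 1) div 2) *
      inverse (qpoch (- fps_X) fps_X n * qpoch fps_X fps_X (M - n)))"
    unfolding shift lambert_sum_eq[OF order.refl] sum_distrib_left e
    by (intro sum.cong refl) (simp add: fps_inverse_mult mult.assoc)
  finally show ?thesis .
qed

section \<open>Passage from the finite identity to the infinite series\<close>

lemma fps_X_power_dvd_denominator_diff:
  assumes "n \<le> M"
  shows "fps_X ^ Suc (M - n) dvd
    qpoch (fps_X ^ 2) (fps_X ^ 2) n * qpoch_inf (fps_X ^ (n + 1)) (fps_X :: 'a::field fps)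
    - qpoch (- fps_X) fps_X n * qpoch fps_X fps_X (M - n)"
proof -
  let ?X = "fps_X :: 'a fps"
  \<comment> \<open>Truncating \<open>?Q\<close> at length \<open>M\<close> costs only an error
    divisible by q^(n+1+M). Then (q;q)_n times \<open>?P\<close> is (q;q)_(n+M), which extends
    (q;q)_(M-n) by \<open>n + n\<close> factors.\<close>
  let ?Q = "qpoch_inf (?X ^ (n + 1)) ?X" and ?P = "qpoch (?X ^ (n + 1)) ?X M"
  have "qpoch (?X ^ 2) (?X ^ 2) n * ?Q - qpoch (- ?X) ?X n * qpoch ?X ?X (M - n)
      = qpoch (- ?X) ?X n * (qpoch ?X ?X n * (?Q - ?P)
        + (qpoch ?X ?X n * ?P - qpoch ?X ?X (M - n)))"
    by (simp add: qpoch_square algebra_simps)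
  moreover have "?X ^ Suc (M - n) dvd ?Q - ?P"
    using fps_X_power_dvd_qpoch_inf_diff[of "n + 1" M]
    by (rule dvd_trans[rotated]) (auto intro: le_imp_power_dvd)
  moreover have "?X ^ Suc (M - n) dvd qpoch ?X ?X n * ?P - qpoch ?X ?X (M - n)"
    using dvd_qpoch_diff[of ?X ?X "M - n" "n + n"] assms qpoch_add[of ?X ?X n M]
    by (simp add: add.commute)
  ultimately show ?thesis
    by (metis dvd_add dvd_mult)
qed

theorem theorem3p2:
  fixes q :: "'a::field_char_0 fps"
  assumes "q = fps_X"
  shows "(\<forall>n\<ge>1. convergent (\<lambda>L. qpoch (q ^ (n + 1)) q L)) \<and>
    (\<lambda>n. q ^ n / (1 + q ^ n) * (1 / qpoch q q (n - 1))) summable_on {1..} \<and>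
    (\<lambda>n. q ^ (n * (n + 1) div 2) / (qpoch (q ^ 2) (q ^ 2) n * qpoch_inf (q ^ (n + 1)) q))
      summable_on {1..} \<and>
    (\<Sum>\<^sub>\<infinity>n\<in>{1..}. q ^ n / (1 + q ^ n) * (1 / qpoch q q (n - 1)))
      = (\<Sum>\<^sub>\<infinity>n\<in>{1..}. q ^ (n * (n + 1) div 2) /
          (qpoch (q ^ 2) (q ^ 2) n * qpoch_inf (q ^ (n + 1)) q))"
proof -
  define f where "f n = q ^ n / (1 + q ^ n) * (1 / qpoch q q (n - 1))" for n
  define D where "D n = qpoch (q ^ 2) (q ^ 2) n * qpoch_inf (q ^ (n + 1)) q" for n
  define g where "g n = q ^ (n * (n + 1) div 2) / D n" for n
  have conv: "convergent (\<lambda>L. qpoch (q ^ (n + 1)) q L)" for n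
    unfolding assms convergent_def using qpoch_tendsto_fps by blast
  \<comment> \<open>Constant term 1 makes \<open>D n\<close> a unit, so dividing by it is
    multiplying by \<open>inverse (D n)\<close>.\<close>
  have D0: "D n $ 0 = 1" for n
  proof -
    have "q ^ (n + 1) dvd qpoch_inf (q ^ (n + 1)) q - 1"
      using fps_X_power_dvd_qpoch_inf_diff[of "n + 1" 0, where 'a = 'a] by (simp add: assms)
    then have "(qpoch_inf (q ^ (n + 1)) q - 1) $ 0 = 0"
      unfolding assms fps_X_power_dvd_iff by (metis add_gr_0 zero_less_one)
    then show ?thesis
      by (simp add: D_def assms)
  qed
  have g_eq: "g n = q ^ (n * (n + 1) div 2) * inverse (D n)" for n
    by (simp add: g_def fps_divide_unit D0)
  have T: "n \<le> n * (n + 1) div 2" for n :: nat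
    by (induction n) auto
  have f_low: "f n $ j = 0" if "j < n" for n j
    using that by (simp add: f_def assms fps_divide_unit mult.assoc fps_X_power_mult_nth)
  have g_low: "g n $ j = 0" if "j < n" for n j
    using that T[of n] by (simp add: g_eq assms fps_X_power_mult_nth)
  have "(\<Sum>n=1..M. f n $ M) = (\<Sum>n=1..M. g n $ M)" for M
  proof -
    have "g n $ M = (q ^ (n * (n + 1) div 2) *
        inverse (qpoch (- q) q n * qpoch q q (M - n))) $ M" if "n \<in> {1..M}" for n
    proof -
      let ?B = "qpoch (- q) q n * qpoch q q (M - n)"
      have "q ^ Suc (M - n) dvd inverse (D n) - inverse ?B"
        using fps_X_power_dvd_denominator_diff[of n M] that D0[of n]
        by (intro dvd_inverse_diff_fps) (simp_all add: D_def assms)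
      then have "q ^ (n * (n + 1) div 2) * q ^ Suc (M - n) dvd
          q ^ (n * (n + 1) div 2) * (inverse (D n) - inverse ?B)"
        by (rule mult_dvd_mono[OF dvd_refl])
      \<comment> \<open>The reciprocals agree only up to order M - n, but the prefactor has order at
        least n, which restores precision up to coefficient \<open>M\<close>.\<close>
      moreover have "M < n * (n + 1) div 2 + Suc (M - n)"
        using T[of n] by linarith
      ultimately have "(q ^ (n * (n + 1) div 2) * (inverse (D n) - inverse ?B)) $ M = 0"
        unfolding assms power_add[symmetric] fps_X_power_dvd_iff by blast
      then show ?thesis
        by (simp add: g_eq right_diff_distrib)
    qed
    then show ?thesis
      using arg_cong[OF sum_lambert_eq_sum_theta_finite[of M, where 'a = 'a], of "\<lambda>h. h $ M"]
      by (simp add: fps_sum_nth f_def assms)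
  qed
  then have "(f has_sum Abs_fps (\<lambda>j. \<Sum>n=1..j. g n $ j)) {1..}"
    using has_sum_fps_triangular[of f] f_low by simp
  moreover have "(g has_sum Abs_fps (\<lambda>j. \<Sum>n=1..j. g n $ j)) {1..}"
    using has_sum_fps_triangular[of g] g_low by simp
  ultimately have "f summable_on {1..} \<and> g summable_on {1..} \<and> infsum f {1..} = infsum g {1..}"
    by (simp add: has_sum_iff)
  then show ?thesis
    using conv unfolding f_def g_def D_def by blast
qed

end
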